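(* Let $n,k\in\mathbb N$, $n\ge5$, $k\ge3$, and $\varepsilon\in[0,\frac{2}{n-1}]$. Let $U\in\{-,+,0\}^*$ be a whole $bc$-code and let $P$ be a word of length $n$ over $A_n$ consisting of $n$ distinct letters. Suppose that (1) $|U|\ge n$; (2) $f_{P}(U^k)$ has suffix $P$; (3) $f_{P}(U^k)\in\mathbf D^{\varepsilon}_{\ge3n-3,n}\cap\mathbf T_n$. Then for every cyclic shift $U_2U_1$ of $U$ (where $U=U_1U_2$) that is a whole $bc$-code: (a) $f_{P}((U_2U_1)^k)$ has suffix $P$; (b) $f_{P}((U_2U_1)^k)\in\mathbf D^{\varepsilon}_{\ge3n-3,n}\cap\mathbf T_n$.
   Context: $A_n$ is an alphabet of $n$ letters. The period $\mathrm{per}(w)$ of a finite nonempty word $w$ is the least $p\ge1$ with $w(i)=w(i+p)$ for all $1\le i\le|w|-p$. $\mathbf T_n$ is the set of words over $A_n$ all of whose nonempty factors $v$ satisfy $|v|/\mathrm{per}(v)\le\frac n{n-1}$. $\mathbf D^{\varepsilon}_{\ge3n-3,n}$ is the set of words over $A_n$ every factor $v$ of which with $\mathrm{per}(v)\ge3n-3$ satisfies $\frac{|v|+\varepsilon}{\mathrm{per}(v)}\le\frac n{n-1}$. Codes are words over the three symbols $-,+,0$. A code is a whole $bc$-code if it is a concatenation of the blocks $-+$ and $-+0$, or a concatenation of the blocks $-+$ and $0-+$ (these blocks are the images under $\phi$ of the symbols $b$ and $c$). Decoding: given a word $P$ of $n$ distinct letters (the "premise") and a whole $bc$-code or a power of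 one $C=C_1\cdots C_t$, the word $f_P(C)=x_1\cdots x_t$ is defined letter by letter so that in the word $Px_1\cdots x_t$ the letter $x_i$ equals the letter standing $n-1$ positions to the left of it if $C_i$ is $-$, $n$ positions to the left if $C_i$ is $0$, and $n+1$ positions to the left if $C_i$ is $+$. (A whole $bc$-code does not start with $+$, so this is well defined.) *)

theory Defs
  imports Complex_Main "HOL-Library.Sublist"
begin

(* Words are lists, factors are contiguous sublists (sublist), and the alphabet A_n is an
   arbitrary set A with card A = n. *)

(* The period is meant for nonempty words; per [] = 1 is never used. *)
definition per :: "'a list \<Rightarrow> nat" where
  "per w = (LEAST p. 1 \<le> p \<and> (\<forall>i. i + p < length w \<longrightarrow> w ! i = w ! (i + p)))"

definition T_words :: "'a set \<Rightarrow> 'a list set" where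
  "T_words A = {w \<in> lists A. \<forall>v. sublist v w \<longrightarrow> v \<noteq> [] \<longrightarrow>
     real (length v) / real (per v) \<le> real (card A) / (real (card A) - 1)}"

(* D_words \<epsilon> m A is the set D^\<epsilon>_{\<ge>m,n} with n = card A. *)
definition D_words :: "real \<Rightarrow> nat \<Rightarrow> 'a set \<Rightarrow> 'a list set" where
  "D_words \<epsilon> m A = {w \<in> lists A. \<forall>v. sublist v w \<longrightarrow> v \<noteq> [] \<longrightarrow> m \<le> per v \<longrightarrow>
     (real (length v) + \<epsilon>) / real (per v) \<le> real (card A) / (real (card A) - 1)}"

datatype code_symbol = Minus | Plus | Zero

type_synonym code = "code_symbol list"

definition whole_bc_code :: "code \<Rightarrow> bool" where
  "whole_bc_code C \<longleftrightarrow>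
     (\<exists>bs. set bs \<subseteq> {[Minus, Plus], [Minus, Plus, Zero]} \<and> C = concat bs) \<or>
     (\<exists>bs. set bs \<subseteq> {[Minus, Plus], [Zero, Minus, Plus]} \<and> C = concat bs)"

definition word_power :: "'a list \<Rightarrow> nat \<Rightarrow> 'a list" where
  "word_power w k = concat (replicate k w)"

fun lookback :: "nat \<Rightarrow> code_symbol \<Rightarrow> nat" where
  "lookback n Minus = n - 1"
| "lookback n Zero = n"
| "lookback n Plus = n + 1"

(* extend n w C continues w letter by letter: the letter appended to w stands at the 0-based
   position length w.  The subtraction is truncated only if the code starts with Plus on a word
   of length n, which does not happen for whole bc-codes. *)
fun extend :: "nat \<Rightarrow> 'a list \<Rightarrow> code \<Rightarrow> 'a list" where
  "extend n w [] = w"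
| "extend n w (c # cs) = extend n (w @ [w ! (length w - lookback n c)]) cs"

definition decode :: "'a list \<Rightarrow> code \<Rightarrow> 'a list" where
  "decode P C = drop (length P) (extend (length P) P C)"

end

theory Submission
  imports Defs
begin

text \<open>
  Write \<open>t\<close> for the length of \<open>U\<close> and \<open>N = k * t\<close>, and let \<open>w\<close> be the infinite word that starts with
  \<open>P\<close> and is continued by the code \<open>U U U \<dots>\<close>. Three symmetries of \<open>w\<close> carry the argument.

  \<^item> Wherever the code does not stand at a plus, the last \<open>n\<close> letters are pairwise distinct
    (\<open>coded_state\<close>), because the pair minus-plus and the symbol zero merely permute them. A code
    determines a word up to the names of the letters of such a premise (\<open>coded_eq_iff\<close>). So
    shifting \<open>w\<close> by \<open>t\<close> only renames letters, and the word decoded from \<open>U\<^sub>2 U\<^sub>1\<close> is, up to a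
    renaming, \<open>w\<close> shifted by \<open>s\<close>, the length of \<open>U\<^sub>1\<close>.
  \<^item> The suffix hypothesis says that after \<open>N\<close> letters the premise \<open>P\<close> itself is back, so \<open>w\<close> has
    period \<open>N\<close>. This passes to the shifted word and gives (a).
  \<^item> Periods of factors only depend on which positions carry equal letters. Hence a
    factor of \<open>w\<close> of length at most \<open>(k - 1) * t + 1\<close>, wherever it starts, can be moved by multiples
    of \<open>t\<close> into the given word of length \<open>N\<close> (\<open>window_representative\<close>), so that (b) holds for it.

  It remains to treat factors of length between \<open>(k - 1) * t + 2\<close> and \<open>N\<close>. Suppose that one
  of length \<open>l\<close> violates a bound with the period \<open>p\<close>. Its prefix and its suffix of length \<open>l - p\<close> coincide, and as
  \<open>w\<close> has period \<open>N\<close>, that suffix is repeated at the complementary distance \<open>q = N - p\<close> as well. Now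
  \<open>p\<close> is so close to \<open>N\<close> that \<open>q \<le> p\<close>: an overlap that is too long for \<open>p\<close> is also too long for
  \<open>q\<close>. The repetition with period \<open>q\<close> that goes beyond the bound by the least amount fits into a
  window of length \<open>(k - 1) * t + 1\<close>, which is impossible (\<open>no_long_repetition\<close>). In the case of
  \<open>D_words\<close> the overlap may be shorter than what \<open>p\<close> allows, but as \<open>\<epsilon> \<le> 2 / (n - 1)\<close> it is still
  too long for every period up to \<open>p - 2\<close>, and even \<open>q \<le> p - 2\<close> holds there.
\<close>

section \<open>Periods and factors\<close>

lemma per_is_period:
  assumes "v \<noteq> []"
  shows "1 \<le> per v \<and> (\<forall>i. i + per v < length v \<longrightarrow> v ! i = v ! (i + per v))"
  unfolding per_def
proof (rule LeastI)
  show "1 \<le> length v \<and> (\<forall>i. i + length v < length v \<longrightarrow> v ! i = v ! (i + length v))"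
    using assms by (cases v) auto
qed

lemma per_le:
  assumes "1 \<le> p" "\<And>i. i + p < length v \<Longrightarrow> v ! i = v ! (i + p)"
  shows "per v \<le> p"
  unfolding per_def using assms by (intro Least_le) auto

definition fac :: "(nat \<Rightarrow> 'a) \<Rightarrow> nat \<Rightarrow> nat \<Rightarrow> 'a list" where
  "fac w a l = map w [a..<a + l]"

lemma length_fac [simp]: "length (fac w a l) = l"
  by (simp add: fac_def)

lemma nth_fac [simp]: "i < l \<Longrightarrow> fac w a l ! i = w (a + i)"
  by (simp add: fac_def)

lemma fac_eq_Nil [simp]: "fac w a l = [] \<longleftrightarrow> l = 0"
  by (simp flip: length_0_conv)

lemma sublist_fac_iff:
  "sublist v (fac w b N) \<longleftrightarrow> (\<exists>a l. b \<le> a \<and> a + l \<le> b + N \<and> v = fac w a l)"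
proof
  assume "sublist v (fac w b N)"
  then obtain xs ys where *: "fac w b N = xs @ v @ ys"
    by (auto simp: sublist_def)
  then have len: "N = length xs + length v + length ys"
    by (metis length_append length_fac add.assoc)
  have "v = fac w (b + length xs) (length v)"
  proof (rule nth_equalityI)
    fix i assume i: "i < length v"
    then have "v ! i = fac w b N ! (length xs + i)"
      unfolding * by (simp add: nth_append)
    then show "v ! i = fac w (b + length xs) (length v) ! i"
      using i len by (simp add: add.assoc)
  qed simp
  then show "\<exists>a l. b \<le> a \<and> a + l \<le> b + N \<and> v = fac w a l"
    using len by (intro exI[of _ "b + length xs"] exI[of _ "length v"]) simp
next
  assume "\<exists>a l. b \<le> a \<and> a + l \<le> b + N \<and> v = fac w a l"
  then obtain a l where a: "b \<le> a" "a + l \<le> b + N" "v = fac w a l" by blast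
  have "[b..<b+N] = [b..<a] @ [a..<a+l] @ [a+l..<b+N]"
    using a upt_add_eq_append[of b a "b+N-a"] upt_add_eq_append[of a "a+l" "b+N-(a+l)"] by simp
  then have "fac w b N = map w [b..<a] @ v @ map w [a+l..<b+N]"
    using a by (simp add: fac_def)
  then show "sublist v (fac w b N)"
    by (auto simp: sublist_def)
qed

text \<open>The period only sees the equality pattern of the letters, so it survives every renaming.\<close>

lemma per_fac_cong:
  assumes "\<And>i j. i < l \<Longrightarrow> j < l \<Longrightarrow> w (a + i) = w (a + j) \<longleftrightarrow> w' (b + i) = w' (b + j)"
  shows "per (fac w a l) = per (fac w' b l)"
proof -
  have "(\<forall>i. i + p < l \<longrightarrow> fac w a l ! i = fac w a l ! (i + p)) \<longleftrightarrow>
        (\<forall>i. i + p < l \<longrightarrow> fac w' b l ! i = fac w' b l ! (i + p))" for p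
    using assms[of _ "_ + p"] by (auto simp: add.assoc)
  then show ?thesis
    by (simp add: per_def)
qed

text \<open>
  As the least period is the most restrictive one, the bound may be demanded for all periods of a
  factor. In this form it can be used without computing least periods.
\<close>

lemma T_words_fac_iff:
  assumes "2 \<le> card A"
  shows "fac w b N \<in> T_words A \<longleftrightarrow> fac w b N \<in> lists A \<and>
    (\<forall>a l p. b \<le> a \<longrightarrow> a + l \<le> b + N \<longrightarrow> 1 \<le> p \<longrightarrow> (\<forall>i. i + p < l \<longrightarrow> w (a + i) = w (a + i + p)) \<longrightarrow>
       l * (card A - 1) \<le> p * card A)" (is "_ \<longleftrightarrow> _ \<and> ?R")
proof -
  have frac: "real x / real y \<le> real (card A) / (real (card A) - 1) \<longleftrightarrow> x * (card A - 1) \<le> y * card A"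
    if "1 \<le> y" for x y
  proof -
    have "real x / real y \<le> real (card A) / (real (card A) - 1) \<longleftrightarrow>
        real x * real (card A - 1) \<le> real y * real (card A)"
      using that assms by (simp add: divide_simps of_nat_diff mult.commute)
    then show ?thesis by (simp only: of_nat_mult[symmetric] of_nat_le_iff)
  qed
  have "(\<forall>v. sublist v (fac w b N) \<longrightarrow> v \<noteq> [] \<longrightarrow>
     real (length v) / real (per v) \<le> real (card A) / (real (card A) - 1)) \<longleftrightarrow> ?R" (is "?L \<longleftrightarrow> _")
  proof
    assume L: ?L
    show ?R
    proof (intro allI impI)
      fix a l p assume *: "b \<le> a" "a + l \<le> b + N" "1 \<le> p" "\<forall>i. i + p < l \<longrightarrow> w (a + i) = w (a + i + p)"
      show "l * (card A - 1) \<le> p * card A"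
      proof (cases "l = 0")
        case False
        have "real l / real (per (fac w a l)) \<le> real (card A) / (real (card A) - 1)"
          using L *(1,2) False unfolding sublist_fac_iff by (metis fac_eq_Nil length_fac)
        moreover have "1 \<le> per (fac w a l)"
          using False per_is_period by (metis fac_eq_Nil)
        moreover have "per (fac w a l) \<le> p"
          using * by (intro per_le) (auto simp: add.assoc)
        ultimately show ?thesis
          using frac by (meson le_trans mult_le_mono1)
      qed simp
    qed
  next
    assume R: ?R
    show ?L
    proof (intro allI impI)
      fix v assume v: "sublist v (fac w b N)" "v \<noteq> []"
      then obtain a l where a: "b \<le> a" "a + l \<le> b + N" "v = fac w a l"
        unfolding sublist_fac_iff by blast
      have *: "1 \<le> per v" "\<forall>i. i + per v < l \<longrightarrow> w (a + i) = w (a + i + per v)"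
        using per_is_period[OF v(2)] a(3) by (auto simp: add.assoc)
      then show "real (length v) / real (per v) \<le> real (card A) / (real (card A) - 1)"
        using R a frac by simp
    qed
  qed
  then show ?thesis
    by (simp add: T_words_def)
qed

lemma D_words_fac_iff:
  "fac w b N \<in> D_words \<epsilon> m A \<longleftrightarrow> fac w b N \<in> lists A \<and>
    (\<forall>a l. b \<le> a \<longrightarrow> a + l \<le> b + N \<longrightarrow> l \<noteq> 0 \<longrightarrow> m \<le> per (fac w a l) \<longrightarrow>
       (real l + \<epsilon>) / real (per (fac w a l)) \<le> real (card A) / (real (card A) - 1))"
proof -
  have "(\<forall>v. sublist v (fac w b N) \<longrightarrow> Q v) \<longleftrightarrow>
      (\<forall>a l. b \<le> a \<longrightarrow> a + l \<le> b + N \<longrightarrow> Q (fac w a l))" for Q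
    unfolding sublist_fac_iff by blast
  then show ?thesis
    by (simp add: D_words_def)
qed

section \<open>Repetitions in words that are periodic up to renaming\<close>

lemma shift_mult:
  fixes w :: "nat \<Rightarrow> 'a"
  assumes "\<And>i j. w (i + t) = w (j + t) \<longleftrightarrow> w i = w j"
  shows "w (i + m * t) = w (j + m * t) \<longleftrightarrow> w i = w j"
proof (induction m)
  case (Suc m)
  then show ?case
    using assms[of "i + m * t" "j + m * t"] by (simp add: ac_simps)
qed simp

text \<open>
  The word has period \<open>k * t\<close>, but already the shift by \<open>t\<close> preserves equality of letters. Only the
  factors inside one window of length \<open>k * t\<close> are assumed to satisfy the bound on repetitions.
\<close>

locale circular_word =
  fixes w :: "nat \<Rightarrow> 'a" and n k t b :: nat
  assumes n: "5 \<le> n" and k: "3 \<le> k" and t: "1 \<le> t"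
    and shift: "\<And>i j. w (i + t) = w (j + t) \<longleftrightarrow> w i = w j"
    and circular: "\<And>i. w (i + k * t) = w i"
    and free: "\<And>a l p. b \<le> a \<Longrightarrow> a + l \<le> b + k * t \<Longrightarrow> 1 \<le> p \<Longrightarrow>
      (\<And>i. i + p < l \<Longrightarrow> w (a + i) = w (a + i + p)) \<Longrightarrow> l * (n - 1) \<le> p * n"
begin

text \<open>
  Among the starting positions congruent to \<open>a\<close> modulo \<open>t\<close>, one lies among the first \<open>t\<close> of the
  window; from there \<open>(k - 1) * t + 1\<close> letters still fit.
\<close>

lemma window_representative:
  assumes "l \<le> (k - 1) * t + 1"
  obtains a' where "b \<le> a'" "a' + l \<le> b + k * t"
    "\<And>i j. w (a + i) = w (a + j) \<longleftrightarrow> w (a' + i) = w (a' + j)"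
proof -
  \<comment> \<open>Adding \<open>b * t\<close> to \<open>a\<close> moves the factor beyond the start \<open>b\<close> of the window.\<close>
  define r where "r = (a + b * t - b) mod t"
  define d where "d = (a + b * t - b) div t"
  have bt: "b \<le> b * t" using t by simp
  have eq: "a + b * t = (b + r) + d * t"
    using bt mod_div_mult_eq[of "a + b * t - b" t] unfolding r_def d_def by linarith
  have "w (a + i) = w (a + j) \<longleftrightarrow> w (b + r + i) = w (b + r + j)" for i j
  proof -
    have "w (a + i) = w (a + j) \<longleftrightarrow> w (a + i + b * t) = w (a + j + b * t)"
      by (simp add: shift_mult[of w t, OF shift])
    also have "\<dots> \<longleftrightarrow> w ((b + r + i) + d * t) = w ((b + r + j) + d * t)"
    proof -
      have "a + x + b * t = b + r + x + d * t" for x using eq by linarith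
      then show ?thesis by presburger
    qed
    also have "\<dots> \<longleftrightarrow> w (b + r + i) = w (b + r + j)"
      by (rule shift_mult[of w t, OF shift])
    finally show ?thesis .
  qed
  moreover have "r < t" using t by (simp add: r_def)
  moreover have "k * t = (k - 1) * t + t" using k by (simp add: algebra_simps)
  ultimately show ?thesis
    using assms by (intro that[of "b + r"]) auto
qed

lemma free_short:
  assumes "l \<le> (k - 1) * t + 1" "1 \<le> p" and per: "\<And>i. i + p < l \<Longrightarrow> w (a + i) = w (a + i + p)"
  shows "l * (n - 1) \<le> p * n"
proof -
  obtain a' where a': "b \<le> a'" "a' + l \<le> b + k * t"
    "\<And>i j. w (a + i) = w (a + j) \<longleftrightarrow> w (a' + i) = w (a' + j)"
    using window_representative[OF assms(1)] by metis
  show ?thesis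
    using a' per assms(2) by (intro free[of a']) (auto simp: add.assoc)
qed

text \<open>
  Already \<open>n * k \<le> 2 * (k - 1) * (n - 1)\<close> suffices, and this amounts to \<open>2 \<le> (k - 2) * (n - 2)\<close>.
\<close>

lemma size_bound: "n * (k * t) \<le> (2 * ((k - 1) * t) + 1) * (n - 1)"
proof -
  obtain n' k' where *: "n = n' + 5" "k = k' + 3"
    using n k by (metis le_iff_add add.commute)
  have "n * k \<le> 2 * (k - 1) * (n - 1)"
    unfolding * by (simp add: algebra_simps)
  then have "n * k * t \<le> 2 * (k - 1) * (n - 1) * t"
    by (rule mult_le_mono1)
  then show ?thesis by (simp add: algebra_simps)
qed

text \<open>
  The two occurrences of the overlap of length \<open>l - p\<close> are also \<open>q = k * t - p\<close> apart, measured
  from the second one to the next copy of the first one. The assumption \<open>excess\<close> says that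
  this overlap is too long for the period \<open>q\<close>, and \<open>large\<close> makes \<open>q\<close> so small that a shortest
  violation lies within the reach of \<open>free_short\<close>.
\<close>

lemma no_long_repetition:
  assumes per: "\<And>i. i + p < l \<Longrightarrow> w (a + i) = w (a + i + p)"
    and "p < l" "l \<le> k * t"
    and large: "((k - 1) * t + 1) * (n - 1) \<le> p * n"
    and excess: "k * t - p < (n - 1) * (l - p)"
  shows False
proof -
  define q where "q = k * t - p"
  \<comment> \<open>The least overlap that the period \<open>q\<close> does not allow.\<close>
  define e where "e = q div (n - 1) + 1"
  define M where "M = (k - 1) * t"
  have q: "1 \<le> q" "p + q = k * t" using assms(2,3) by (auto simp: q_def)
  have e: "e \<le> l - p"
  proof -
    have "q < (l - p) * (n - 1)" using excess by (simp only: q_def mult.commute)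
    then have "q div (n - 1) < l - p" by (rule less_mult_imp_div_less)
    then show ?thesis by (simp add: e_def)
  qed
  have eq: "q < e * (n - 1)"
    using n dividend_less_div_times[of "n - 1" q] by (simp add: e_def add_mult_distrib)
  have "(q + q div (n - 1)) * (n - 1) \<le> q * (n - 1) + q"
    by (simp add: add_mult_distrib)
  also have "\<dots> = q * n" using n by (cases n) auto
  also have "\<dots> \<le> M * (n - 1)"
  proof -
    have "q * n + p * n = n * (k * t)" using q(2) by (metis add_mult_distrib add.commute mult.commute)
    then show ?thesis
      using size_bound large n unfolding M_def[symmetric] by (cases n) (auto simp: algebra_simps)
  qed
  finally have "q + q div (n - 1) \<le> M" using n by simp
  then have short: "q + e \<le> (k - 1) * t + 1" by (simp add: e_def M_def)
  have "(q + e) * (n - 1) \<le> q * n"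
  proof (rule free_short[OF short q(1)])
    fix i assume "i + q < q + e"
    then have "w (a + i) = w (a + i + p)" using e by (intro per) simp
    moreover have "a + i + k * t = a + p + i + q" "a + i + p = a + p + i"
      using q(2) by linarith+
    ultimately show "w (a + p + i) = w (a + p + i + q)"
      using circular[of "a + i"] by metis
  qed
  then show False using eq n by (cases n) (auto simp: add_mult_distrib)
qed

text \<open>
  A violation with period \<open>p\<close> can be cut down to the least length that still violates the bound.
  If even this is too long for \<open>free_short\<close>, then \<open>k * t \<le> 2 * p\<close>, so the complementary period is
  at most \<open>p\<close> and the overlap is too long for it as well.
\<close>

lemma free_circular:
  assumes "l \<le> k * t" "1 \<le> p" and per: "\<And>i. i + p < l \<Longrightarrow> w (a + i) = w (a + i + p)"
  shows "l * (n - 1) \<le> p * n"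
proof (rule ccontr)
  assume "\<not> ?thesis"
  then have viol: "p * n < l * (n - 1)" by simp
  define M where "M = (k - 1) * t"
  have pn: "p * n = p * (n - 1) + p" using n by (cases n) auto
  then have "p * (n - 1) < l * (n - 1)" using viol by linarith
  then have pl: "p < l" by simp
  then have exc: "p < (n - 1) * (l - p)"
    using viol pn by (simp add: diff_mult_distrib2 mult.commute)
  define l0 where "l0 = p + p div (n - 1) + 1"
  have "p div (n - 1) < l - p"
    using exc by (intro less_mult_imp_div_less) (simp only: mult.commute)
  then have l0: "l0 \<le> l" unfolding l0_def using pl by simp
  have l0': "p * n < l0 * (n - 1)"
    using n dividend_less_div_times[of "n - 1" p] by (simp add: pn l0_def add_mult_distrib)
  have "\<not> l0 \<le> M + 1"
  proof
    assume "l0 \<le> M + 1"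
    then have "l0 * (n - 1) \<le> p * n"
      unfolding M_def using assms(2) l0 by (intro free_short[of _ _ a] per) auto
    then show False using l0' by simp
  qed
  then have "M + 1 \<le> p + p div (n - 1)" by (simp add: l0_def)
  then have "(M + 1) * (n - 1) \<le> (p + p div (n - 1)) * (n - 1)" by (rule mult_le_mono1)
  also have "\<dots> \<le> p * n" by (simp add: pn add_mult_distrib)
  finally have large: "(M + 1) * (n - 1) \<le> p * n" .
  have "(2 * M + 1) * (n - 1) \<le> 2 * ((M + 1) * (n - 1))"
    by (simp add: add_mult_distrib)
  moreover have "n * (2 * p) = 2 * (p * n)" by simp
  ultimately have "n * (k * t) \<le> n * (2 * p)"
    using size_bound large unfolding M_def[symmetric] by linarith
  then have "k * t \<le> 2 * p" using n mult_le_cancel1[of n "k * t" "2 * p"] by linarith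
  then have "k * t - p < (n - 1) * (l - p)" using exc by linarith
  from no_long_repetition[OF per pl assms(1) large[unfolded M_def] this] show False .
qed

text \<open>
  For the bound with \<open>\<epsilon>\<close> it is not possible to cut a violating factor down, because the shorter
  factor may have a period below the threshold. But the length of a long factor itself forces
  \<open>k * t + 2 \<le> 2 * p\<close>, and this gain of 2 makes up for the slack in \<open>viol\<close>.
\<close>

lemma almost_extremal_short:
  assumes "l \<le> k * t" "1 \<le> p" and per: "\<And>i. i + p < l \<Longrightarrow> w (a + i) = w (a + i + p)"
    and viol: "p * n < l * (n - 1) + 2"
  shows "l \<le> (k - 1) * t + 1"
proof (rule ccontr)
  assume long: "\<not> ?thesis"
  define M where "M = (k - 1) * t"
  have T: "l * (n - 1) \<le> p * n" by (rule free_circular[OF assms(1,2) per])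
  have "(M + 2) * (n - 1) \<le> l * (n - 1)" using long by (intro mult_le_mono1) (simp add: M_def)
  with T have large: "(M + 2) * (n - 1) \<le> p * n" by simp
  have pn: "p * n = p * (n - 1) + p" using n by (cases n) auto
  have "(2 * M + 1) * (n - 1) + 3 * (n - 1) = 2 * ((M + 2) * (n - 1))"
    by (simp add: add_mult_distrib)
  moreover have "n * (2 * p) = 2 * (p * n)" by simp
  ultimately have "n * (k * t) + 3 * (n - 1) \<le> n * (2 * p)"
    using size_bound large unfolding M_def[symmetric] by linarith
  moreover have "2 * n \<le> 3 * (n - 1)" using n by simp
  ultimately have "n * (k * t + 2) \<le> n * (2 * p)"
    unfolding add_mult_distrib2 by linarith
  then have big: "k * t + 2 \<le> 2 * p"
    using n mult_le_cancel1[of n "k * t + 2" "2 * p"] by linarith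
  have "3 * 1 \<le> k * t" using k t by (rule mult_le_mono)
  then have p2: "2 \<le> p" using big by simp
  have "p * (n - 1) < l * (n - 1)"
    using viol pn p2 by linarith
  then have pl: "p < l" by simp
  then have "p - 1 \<le> (n - 1) * (l - p)"
    using viol pn by (simp add: diff_mult_distrib2 mult.commute)
  then have excess: "k * t - p < (n - 1) * (l - p)" using big p2 by linarith
  have "((k - 1) * t + 1) * (n - 1) \<le> (M + 2) * (n - 1)"
    by (intro mult_le_mono1) (simp add: M_def)
  then have "((k - 1) * t + 1) * (n - 1) \<le> p * n" using large by (rule le_trans)
  from no_long_repetition[OF per pl assms(1) this excess] show False .
qed

end

section \<open>Infinite words with a code\<close>

text \<open>
  The first \<open>n\<close> letters are the premise. If the code starts with a plus, the truncated subtraction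
  makes its first letter a copy of the letter at position 0.
\<close>

definition coded :: "nat \<Rightarrow> (nat \<Rightarrow> code_symbol) \<Rightarrow> (nat \<Rightarrow> 'a) \<Rightarrow> bool" where
  "coded n c w \<longleftrightarrow> (\<forall>i. w (n + i) = w (n + i - lookback n (c i)))"

text \<open>
  The test \<open>length P < 2\<close> is there for termination: for a premise of length 1, a minus would refer to
  the very letter that is being defined.
\<close>

function decode_stream :: "'a list \<Rightarrow> (nat \<Rightarrow> code_symbol) \<Rightarrow> nat \<Rightarrow> 'a" where
  "decode_stream P c i = (if i < length P \<or> length P < 2 then P ! i
     else decode_stream P c (i - lookback (length P) (c (i - length P))))"
  by pat_completeness auto

lemma lookback_pos: "2 \<le> n \<Longrightarrow> 0 < lookback n x"
  by (cases x) auto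

termination
  by (relation "measure (\<lambda>(P, c, i). i)") (auto intro!: diff_less lookback_pos)

declare decode_stream.simps [simp del]

lemma decode_stream_premise: "i < length P \<Longrightarrow> decode_stream P c i = P ! i"
  by (simp add: decode_stream.simps)

lemma coded_decode_stream: "2 \<le> length P \<Longrightarrow> coded (length P) c (decode_stream P c)"
  unfolding coded_def by (subst decode_stream.simps) auto

lemma extend_append: "extend n w (xs @ ys) = extend n (extend n w xs) ys"
  by (induction xs arbitrary: w) auto

lemma extend_eq_fac:
  assumes "2 \<le> n" "coded n c w"
  shows "extend n (fac w 0 n) (map c [0..<j]) = fac w 0 (n + j)"
proof (induction j)
  case (Suc j)
  have "n + j - lookback n (c j) < n + j" using lookback_pos[OF assms(1)] assms(1) by simp
  then have "fac w 0 (n + j) ! (n + j - lookback n (c j)) = w (n + j)"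
    using assms(2) by (simp add: coded_def)
  then show ?case using Suc by (simp add: extend_append fac_def)
qed simp

lemma word_power_eq: "word_power U k = map (\<lambda>i. U ! (i mod length U)) [0..<k * length U]"
proof (induction k)
  case (Suc k)
  have "word_power U (Suc k) = word_power U k @ U"
    unfolding word_power_def by (simp flip: replicate_append_same)
  moreover have "U = map (\<lambda>i. U ! (i mod length U)) [k * length U..<k * length U + length U]"
    by (rule nth_equalityI) auto
  ultimately have "word_power U (Suc k) = map (\<lambda>i. U ! (i mod length U)) [0..<k * length U] @
      map (\<lambda>i. U ! (i mod length U)) [k * length U..<k * length U + length U]"
    using Suc by metis
  then show ?case
    using upt_add_eq_append[of 0 "k * length U" "length U"] by (simp add: add.commute)
qed (simp add: word_power_def)

lemma decode_word_power:
  assumes "length P = n" "2 \<le> n" "c = (\<lambda>i. U ! (i mod length U))"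
  shows "decode P (word_power U k) = fac (decode_stream P c) n (k * length U)"
proof -
  have "P = fac (decode_stream P c) 0 n"
    using assms(1) by (intro nth_equalityI) (auto simp: decode_stream_premise)
  then have "extend n P (word_power U k) = fac (decode_stream P c) 0 (n + k * length U)"
    using extend_eq_fac[OF assms(2), of c "decode_stream P c"] coded_decode_stream[of P c] assms
    by (simp add: word_power_eq)
  then show ?thesis
    using assms(1) by (simp add: decode_def fac_def drop_map)
qed

lemma coded_relabel:
  assumes "2 \<le> n" "coded n c w" "coded n c w'" "\<And>i. i < n \<Longrightarrow> w' i = \<pi> (w i)"
  shows "w' i = \<pi> (w i)"
proof (induction i rule: less_induct)
  case (less i)
  show ?case
  proof (cases "i < n")
    case False
    then obtain j where j: "i = n + j" by (metis le_iff_add not_less)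
    have "i - lookback n (c j) < i" using lookback_pos[OF assms(1)] assms(1) j by simp
    then show ?thesis using less assms(2,3) j by (simp add: coded_def)
  qed (use assms(4) in simp)
qed

text \<open>
  Every letter is a copy of a letter of the premise that only the code determines, so a
  renaming of the premise renames the whole word.
\<close>

lemma coded_eq_imp:
  assumes "2 \<le> n" "coded n c w" "coded n c w'" "inj_on w {..<n}" "w i = w j"
  shows "w' i = w' j"
proof -
  define \<pi> where "\<pi> = w' \<circ> inv_into {..<n} w"
  have "w' i = \<pi> (w i)" for i
    by (rule coded_relabel[OF assms(1-3)]) (simp add: \<pi>_def assms(4))
  then show ?thesis using assms(5) by metis
qed

lemma coded_eq_iff:
  assumes "2 \<le> n" "coded n c w" "coded n c w'" "inj_on w {..<n}" "inj_on w' {..<n}"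
  shows "w i = w j \<longleftrightarrow> w' i = w' j"
  using coded_eq_imp[of n c w w'] coded_eq_imp[of n c w' w] assms by blast

text \<open>
  A plus at \<open>s\<close> has to be excluded: its letter would be copied from the position just
  before the new premise.
\<close>

lemma coded_shift:
  assumes "coded n c w" "c s \<noteq> Plus"
  shows "coded n (\<lambda>i. c (s + i)) (\<lambda>i. w (s + i))"
  unfolding coded_def
proof
  fix i
  have "lookback n (c (s + i)) \<le> n + i"
    using assms(2) by (cases i; cases "c (s + i)") auto
  then show "w (s + (n + i)) = w (s + (n + i - lookback n (c (s + i))))"
    using assms(1) unfolding coded_def by (metis Nat.add_diff_assoc add.left_commute)
qed

lemma coded_range:
  assumes "2 \<le> n" "coded n c w"
  shows "w i \<in> w ` {..<n}"
proof (induction i rule: less_induct)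
  case (less i)
  show ?case
  proof (cases "i < n")
    case False
    then obtain j where j: "i = n + j" by (metis le_iff_add not_less)
    have "i - lookback n (c j) < i" using lookback_pos[OF assms(1)] assms(1) j by simp
    then show ?thesis using less assms(2) j by (simp add: coded_def)
  qed simp
qed

section \<open>Whole codes\<close>

text \<open>
  Both kinds of whole codes are sequences of the units minus-plus and zero. Locally this means that
  a symbol is a plus exactly if its predecessor is a minus, a condition that is easy to read
  cyclically.
\<close>

definition paired :: "code_symbol \<Rightarrow> code_symbol \<Rightarrow> bool" where
  "paired x y \<longleftrightarrow> (y = Plus \<longleftrightarrow> x = Minus)"

lemma whole_bc_code_paired:
  assumes "whole_bc_code C"
  shows "successively paired C" "C \<noteq> [] \<Longrightarrow> hd C \<noteq> Plus \<and> last C \<noteq> Minus"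
proof -
  obtain bs where bs: "set bs \<subseteq> {[Minus, Plus], [Minus, Plus, Zero], [Zero, Minus, Plus]}"
      and C: "C = concat bs"
    using assms unfolding whole_bc_code_def by blast
  have "successively paired (concat bs) \<and> (concat bs \<noteq> [] \<longrightarrow> hd (concat bs) \<noteq> Plus \<and> last (concat bs) \<noteq> Minus)"
    using bs
  proof (induction bs)
    case (Cons b bs)
    then show ?case
      by (cases "concat bs = []") (auto simp: successively_append_iff paired_def simp del: concat_eq_Nil_conv)
  qed simp
  then show "successively paired C" "C \<noteq> [] \<Longrightarrow> hd C \<noteq> Plus \<and> last C \<noteq> Minus"
    using C by auto
qed

lemma whole_bc_code_cyclic:
  assumes "whole_bc_code C" "C \<noteq> []" "c = (\<lambda>i. C ! (i mod length C))"
  shows "c 0 \<noteq> Plus" "paired (c i) (c (Suc i))"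
proof -
  note C = whole_bc_code_paired[OF assms(1)]
  show "c 0 \<noteq> Plus" using C(2) assms by (simp add: hd_conv_nth)
  show "paired (c i) (c (Suc i))"
  proof (cases "Suc (i mod length C) = length C")
    case True
    then have "i mod length C = length C - 1" "Suc i mod length C = 0"
      by (linarith, simp add: mod_Suc)
    then have "c i = last C" "c (Suc i) = hd C"
      using assms(2,3) by (simp_all add: last_conv_nth hd_conv_nth)
    then show ?thesis using C(2) assms(2) by (simp add: paired_def)
  next
    case False
    then have "Suc (i mod length C) < length C" 
      using assms(2) by (metis Suc_lessI length_greater_0_conv mod_less_divisor)
    then show ?thesis
      using successively_nth[OF C(1)] False assms(3) by (simp add: mod_Suc)
  qed
qed

text \<open>
  The current \<open>n\<close> letters always form the letter set of the premise: zero moves the oldest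
  letter to the end, and minus-plus moves the two oldest letters to the end and swaps them.
\<close>

lemma coded_state:
  assumes "2 \<le> n" "coded n c w" "c 0 \<noteq> Plus" "\<And>i. paired (c i) (c (Suc i))" "c s \<noteq> Plus"
  shows "w ` {s..<s + n} = w ` {..<n}"
  using assms(5)
proof (induction s rule: less_induct)
  case (less s)
  show ?case
  proof (cases s)
    case (Suc r)
    have step: "w (n + i) = w (n + i - lookback n (c i))" for i
      using assms(2) by (simp add: coded_def)
    show ?thesis
    proof (cases "c r")
      case Zero
      have "{s..<s + n} = insert (r + n) {Suc r..<r + n}" using Suc assms(1) by auto
      moreover have "{r..<r + n} = insert r {Suc r..<r + n}" using assms(1) by auto
      moreover have "w (r + n) = w r" using step[of r] Zero by (simp add: add.commute)
      ultimately show ?thesis using less(1)[of r] Suc Zero by simp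
    next
      case Minus
      then show ?thesis using assms(4)[of r] less(2) Suc by (simp add: paired_def)
    next
      case Plus
      then obtain m where m: "r = Suc m" "c m = Minus"
        using assms(3,4) by (metis paired_def not0_implies_Suc)
      have "{s..<s + n} = {m + n, Suc m + n} \<union> {Suc (Suc m)..<m + n}" using Suc m assms(1) by auto
      moreover have "{m..<m + n} = {m, Suc m} \<union> {Suc (Suc m)..<m + n}" using assms(1) by auto
      moreover have "w (m + n) = w (Suc m)"
        using step[of m] m assms(1) by (simp add: add.commute Suc_diff_Suc)
      moreover have "w (Suc m + n) = w m"
        using step[of r] m Plus by (simp add: add.commute)
      ultimately show ?thesis using less(1)[of m] Suc m by (simp add: insert_commute)
    qed
  qed (simp add: lessThan_atLeast0)
qed

lemma coded_state_inj:
  assumes "2 \<le> n" "coded n c w" "c 0 \<noteq> Plus" "\<And>i. paired (c i) (c (Suc i))" "c s \<noteq> Plus"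
    and "inj_on w {..<n}"
  shows "inj_on (\<lambda>i. w (s + i)) {..<n}"
proof -
  have "(\<lambda>i. w (s + i)) ` {..<n} = w ` {s..<s + n}"
    by (simp add: lessThan_atLeast0 add.commute flip: image_image[of w "\<lambda>i. i + s"])
  then have "card ((\<lambda>i. w (s + i)) ` {..<n}) = card {..<n}"
    using coded_state[OF assms(1-5)] assms(6) by (simp add: card_image)
  then show ?thesis by (simp add: eq_card_imp_inj_on)
qed

lemma suffix_fac_iff:
  assumes "length P = n" "\<And>i. i < n \<Longrightarrow> w i = P ! i" "n \<le> N"
  shows "suffix P (fac w n N) \<longleftrightarrow> (\<forall>i<n. w (i + N) = w i)"
proof -
  have "fac w n N = fac w n (N - n) @ fac w N n"
    using assms(3) upt_add_eq_append[of n N n] by (simp add: fac_def add.commute)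
  then have "suffix P (fac w n N) \<longleftrightarrow> P = fac w N n"
    using assms(1) by (auto simp: suffix_def)
  also have "\<dots> \<longleftrightarrow> (\<forall>i<n. w (i + N) = w i)"
    using assms(1,2) by (auto simp: list_eq_iff_nth_eq add.commute)
  finally show ?thesis .
qed

theorem mainTheorem3:
  fixes n k :: nat and \<epsilon> :: real and A :: "'a set" and P :: "'a list" and U :: code
  assumes "n \<ge> 5" and "k \<ge> 3"
    and "0 \<le> \<epsilon>" and "\<epsilon> \<le> 2 / (real n - 1)"
    and "finite A" and "card A = n"
    and "whole_bc_code U"
    and "P \<in> lists A" and "length P = n" and "distinct P"
    and "length U \<ge> n"
    and "suffix P (decode P (word_power U k))"
    and "decode P (word_power U k) \<in> D_words \<epsilon> (3 * n - 3) A \<inter> T_words A"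
  shows "\<forall>U\<^sub>1 U\<^sub>2. U = U\<^sub>1 @ U\<^sub>2 \<longrightarrow> whole_bc_code (U\<^sub>2 @ U\<^sub>1) \<longrightarrow>
    suffix P (decode P (word_power (U\<^sub>2 @ U\<^sub>1) k)) \<and>
    decode P (word_power (U\<^sub>2 @ U\<^sub>1) k) \<in> D_words \<epsilon> (3 * n - 3) A \<inter> T_words A"
proof (intro allI impI)
  fix U\<^sub>1 U\<^sub>2 assume U: "U = U\<^sub>1 @ U\<^sub>2" and whole': "whole_bc_code (U\<^sub>2 @ U\<^sub>1)"
  define t where "t = length U"
  define N where "N = k * t"
  define s where "s = length U\<^sub>1"
  define V where "V = U\<^sub>2 @ U\<^sub>1"
  define c where "c = (\<lambda>i. U ! (i mod length U))"
  define c' where "c' = (\<lambda>i. V ! (i mod length V))"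
  define w where "w = decode_stream P c"
  define w' where "w' = decode_stream P c'"
  have n2: "2 \<le> n" using assms(1) by simp
  have t: "n \<le> t" "1 \<le> t" using assms(1,11) by (auto simp: t_def)
  have lenV: "length V = t" by (simp add: V_def t_def U)
  have V0: "V \<noteq> []" and U0: "U \<noteq> []" using t lenV by (auto simp: t_def)
  have "t \<le> N" using assms(2) by (simp add: N_def)
  then have nN: "n \<le> N" using t by simp
  have dec: "decode P (word_power U k) = fac w n N"
    unfolding w_def N_def t_def using decode_word_power[OF assms(9) n2 c_def] .
  have dec': "decode P (word_power V k) = fac w' n N"
    unfolding w'_def N_def lenV[symmetric] using decode_word_power[OF assms(9) n2 c'_def] .
  have cw: "coded n c w" and cw': "coded n c' w'"
    using coded_decode_stream[of P] assms(9) n2 by (auto simp: w_def w'_def)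
  have wP: "w i = P ! i" "w' i = P ! i" if "i < n" for i
    using that assms(9) by (auto simp: w_def w'_def decode_stream_premise)
  have inj: "inj_on w {..<n}" and inj': "inj_on w' {..<n}"
    using assms(9,10) by (auto simp: inj_on_def wP nth_eq_iff_index_eq)
  note cyc = whole_bc_code_cyclic[OF assms(7) U0 c_def]
  have c_per: "c (i + m * t) = c i" for i m by (simp add: c_def t_def)
  have c'_eq: "c' i = c (s + i)" for i
  proof -
    have "V = rotate s U" by (simp add: V_def U s_def rotate_append)
    then show ?thesis
      using U0 lenV by (simp add: c'_def c_def t_def nth_rotate mod_simps)
  qed
  have cs: "c s \<noteq> Plus"
    using whole_bc_code_cyclic(1)[OF _ V0 c'_def] whole' c'_eq[of 0] by (simp add: V_def)
  have shift: "w (i + t) = w (j + t) \<longleftrightarrow> w i = w j" for i j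
  proof -
    have ct: "c (t + i) = c i" for i using c_per[of i 1] by (simp add: add.commute)
    then have pl: "c t \<noteq> Plus" using cyc(1) ct[of 0] by simp
    show ?thesis
      using coded_eq_iff[OF n2 cw, of "\<lambda>i. w (t + i)" i j] coded_shift[OF cw pl] inj
        coded_state_inj[OF n2 cw cyc pl inj] by (simp add: ct add.commute[of _ t])
  qed
  \<comment> \<open>If the premise itself comes back, not merely a renaming of it, the word repeats.\<close>
  have circ_iff: "(\<forall>i<n. w (i + N) = w i) \<longleftrightarrow> (\<forall>i. w (i + N) = w i)"
  proof -
    have cN: "c (N + i) = c i" for i using c_per[of i k] by (simp add: N_def add.commute)
    then have pl: "c N \<noteq> Plus" using cyc(1) cN[of 0] by simp
    show ?thesis
      using coded_relabel[OF n2 cw, of "\<lambda>i. w (N + i)" "\<lambda>x. x"] coded_shift[OF cw pl]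
      by (auto simp: cN add.commute[of _ N])
  qed
  have circular: "w (i + N) = w i" for i
    using assms(12) suffix_fac_iff[of P n w N, OF assms(9) wP(1) nN] circ_iff by (simp add: dec)
  \<comment> \<open>The word of the cyclic shift is a renaming of the shifted word.\<close>
  have pattern: "w' i = w' j \<longleftrightarrow> w (s + i) = w (s + j)" for i j
    using coded_eq_iff[OF n2 cw', of "\<lambda>i. w (s + i)" i j] coded_shift[OF cw cs] inj'
      coded_state_inj[OF n2 cw cyc cs inj] by (simp add: c'_eq[abs_def])
  have cA: "2 \<le> card A" using n2 assms(6) by simp
  have T: "fac w n N \<in> T_words A" and D: "fac w n N \<in> D_words \<epsilon> (3 * n - 3) A"
    using assms(13) by (auto simp: dec)
  interpret circular_word w n k t n
  proof
    show "l * (n - 1) \<le> p * n" if "n \<le> a" "a + l \<le> n + k * t" "1 \<le> p"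
      "\<And>i. i + p < l \<Longrightarrow> w (a + i) = w (a + i + p)" for a l p
      using T that unfolding T_words_fac_iff[OF cA] N_def assms(6) by blast
  qed (use assms(1,2) t shift circular in \<open>auto simp: N_def\<close>)
  have listsA: "fac w' n N \<in> lists A"
  proof -
    have "w' ` {..<n} \<subseteq> A"
      using assms(8,9) by (auto simp: wP in_lists_conv_set)
    then have "w' i \<in> A" for i using coded_range[OF n2 cw'] by blast
    then show ?thesis by (auto simp: fac_def)
  qed
  have "suffix P (fac w' n N)"
  proof -
    have "w' (i + N) = w' i" for i
      using circular[of "s + i"] by (simp add: pattern add.assoc N_def)
    then show ?thesis
      using suffix_fac_iff[of P n w' N, OF assms(9) wP(2) nN] by simp
  qed
  moreover have "fac w' n N \<in> T_words A"
    unfolding T_words_fac_iff[OF cA] assms(6)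
  proof (intro conjI listsA allI impI)
    fix a l p assume *: "n \<le> a" "a + l \<le> n + N" "1 \<le> p" "\<forall>i. i + p < l \<longrightarrow> w' (a + i) = w' (a + i + p)"
    show "l * (n - 1) \<le> p * n"
      using * by (intro free_circular[of _ _ "s + a"]) (auto simp: N_def pattern add.assoc)
  qed
  moreover have "fac w' n N \<in> D_words \<epsilon> (3 * n - 3) A"
    unfolding D_words_fac_iff
  proof (intro conjI listsA allI impI)
    fix a l assume a: "n \<le> a" "a + l \<le> n + N" "l \<noteq> 0" "3 * n - 3 \<le> per (fac w' a l)"
    define p where "p = per (fac w' a l)"
    have per: "1 \<le> p" "\<And>i. i + p < l \<Longrightarrow> w (s + a + i) = w (s + a + i + p)"
      using per_is_period[of "fac w' a l"] a(3) by (auto simp: p_def pattern add.assoc)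
    show "(real l + \<epsilon>) / real (per (fac w' a l)) \<le> real (card A) / (real (card A) - 1)"
    proof (rule ccontr)
      assume "\<not> ?thesis"
      then have viol: "\<not> (real l + \<epsilon>) / real p \<le> real n / (real n - 1)" by (simp add: p_def assms(6))
      then have "real p * real n < (real l + \<epsilon>) * (real n - 1)"
        using per(1) assms(1) by (simp add: divide_simps mult.commute not_le)
      also have "\<dots> \<le> real l * (real n - 1) + 2"
        using assms(1,4) by (simp add: field_simps)
      also have "\<dots> = real (l * (n - 1) + 2)" using assms(1) by (simp add: of_nat_diff)
      finally have "p * n < l * (n - 1) + 2"
        by (simp only: of_nat_mult[symmetric] of_nat_less_iff)
      then have "l \<le> (k - 1) * t + 1"
        using a per by (intro almost_extremal_short[of l p "s + a"]) (auto simp: N_def)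
      then obtain a' where a': "n \<le> a'" "a' + l \<le> n + k * t"
        "\<And>i j. w (s + a + i) = w (s + a + j) \<longleftrightarrow> w (a' + i) = w (a' + j)"
        using window_representative by metis
      have "per (fac w a' l) = p"
        unfolding p_def by (rule per_fac_cong) (simp add: pattern a'(3)[symmetric] add.assoc)
      moreover have "(real l + \<epsilon>) / real (per (fac w a' l)) \<le> real n / (real n - 1)"
        if "3 * n - 3 \<le> per (fac w a' l)"
        using D a(3) a'(1,2) that unfolding D_words_fac_iff N_def assms(6) by blast
      ultimately show False
        using a(4) viol by (simp add: p_def)
    qed
  qed
  ultimately show "suffix P (decode P (word_power (U\<^sub>2 @ U\<^sub>1) k)) \<and>
    decode P (word_power (U\<^sub>2 @ U\<^sub>1) k) \<in> D_words \<epsilon> (3 * n - 3) A \<inter> T_words A"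
    using dec' by (simp add: V_def)
qed

end
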